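(* Let $G=(V,E)$ be a regular finite simple graph with $n\ge 2$ vertices, adjacency matrix $A$ and eigenvalues $\lambda_1\ge\lambda_2\ge\cdots\ge\lambda_n$ (listed with multiplicity). Let $k\ge 1$ be an integer and let $p\in\mathbb{R}_k[x]$. Put $W(p)=\max_{u\in V}(p(A))_{uu}$ and $\lambda(p)=\min_{2\le i\le n}p(\lambda_i)$, and assume $p(\lambda_1)>\lambda(p)$. Then $$\alpha_k(G)\le n\,\frac{W(p)-\lambda(p)}{p(\lambda_1)-\lambda(p)}.$$
   Context: $\mathbb{R}_k[x]$ denotes the set of real polynomials of degree at most $k$. The $k$-independence number $\alpha_k(G)$ is the maximum size of a set of vertices of $G$ such that any two distinct vertices of the set are at distance greater than $k$ in $G$ (vertices in different components are at infinite distance). The eigenvalues of a graph are those of its adjacency matrix. *)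

theory Defs
  imports
    "Graph_Theory.Graph_Theory"
    "Jordan_Normal_Form.Char_Poly"
begin

text \<open>
  Finite simple graphs are the \<^locale>\<open>graph\<close>s of the library: finite symmetric digraphs
  without loops and parallel arcs, each undirected edge being a pair of opposite arcs.
\<close>

definition regular_graph :: "('a, 'b) pre_digraph \<Rightarrow> bool" where
  "regular_graph G \<longleftrightarrow> graph G \<and> (\<exists>d. \<forall>v\<in>verts G. out_degree G v = d)"

definition graph_dist :: "('a, 'b) pre_digraph \<Rightarrow> 'a \<Rightarrow> 'a \<Rightarrow> ereal" where
  "graph_dist G u v = wf_digraph.\<mu> G (\<lambda>_. 1) u v"

definition k_independent :: "('a, 'b) pre_digraph \<Rightarrow> nat \<Rightarrow> 'a set \<Rightarrow> bool" where
  "k_independent G k S \<longleftrightarrow>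
     S \<subseteq> verts G \<and> (\<forall>u\<in>S. \<forall>v\<in>S. u \<noteq> v \<longrightarrow> graph_dist G u v > ereal (real k))"

definition k_independence_number :: "('a, 'b) pre_digraph \<Rightarrow> nat \<Rightarrow> nat" where
  "k_independence_number G k = Max {card S | S. k_independent G k S}"

text \<open>
  Rows and columns are indexed by the positions in a list \<open>vs\<close> that enumerates the vertices.
\<close>

definition adjacency_matrix :: "('a, 'b) pre_digraph \<Rightarrow> 'a list \<Rightarrow> real mat" where
  "adjacency_matrix G vs = mat (length vs) (length vs)
     (\<lambda>(i, j). if (vs ! i, vs ! j) \<in> arcs_ends G then 1 else 0)"

definition poly_mat :: "real poly \<Rightarrow> real mat \<Rightarrow> real mat" where
  "poly_mat p A = mat (dim_row A) (dim_row A)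
     (\<lambda>(i, j). \<Sum>m\<le>degree p. coeff p m * (A ^\<^sub>m m) $$ (i, j))"

text \<open>
  The real roots of the characteristic polynomial, with multiplicity and in non-increasing order.
  A real symmetric matrix of size \<open>n\<close> has exactly \<open>n\<close> of them.
\<close>

definition eigenvalue_list :: "real mat \<Rightarrow> real list" where
  "eigenvalue_list A = rev (sorted_list_of_multiset (proots (char_poly A)))"

text \<open>Numbered from 1, so that \<open>nth_eigenvalue A 1\<close> is the largest eigenvalue.\<close>

definition nth_eigenvalue :: "real mat \<Rightarrow> nat \<Rightarrow> real" where
  "nth_eigenvalue A i = eigenvalue_list A ! (i - 1)"

text \<open>The quantities \<open>W(p)\<close> and \<open>\<lambda>(p)\<close> for the matrix \<open>A\<close>.\<close>

definition max_diag_poly :: "real mat \<Rightarrow> real poly \<Rightarrow> real" where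
  "max_diag_poly A p = Max ((\<lambda>u. poly_mat p A $$ (u, u)) ` {..<dim_row A})"

definition min_poly_eigenvalue :: "real mat \<Rightarrow> real poly \<Rightarrow> real" where
  "min_poly_eigenvalue A p = Min ((\<lambda>i. poly p (nth_eigenvalue A i)) ` {2..dim_row A})"

end

theory Submission
  imports Defs "HOL-Analysis.Convex"
begin

text \<open>
  Let \<open>\<lambda> = \<lambda>(p)\<close> and let \<open>M = p(A) - \<lambda> I\<close>. The assumption \<open>p(\<lambda>\<^sub>1) > \<lambda>\<close> makes every eigenvalue
  of the symmetric matrix \<open>M\<close> nonnegative, including \<open>p(\<lambda>\<^sub>1) - \<lambda>\<close>, so \<open>M\<close> is positive semidefinite
  and multiplicities play no role. By regularity the all-ones vector \<open>e\<close> is an eigenvector of \<open>A\<close>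
  for \<open>\<lambda>\<^sub>1\<close>. If \<open>x\<close> is the indicator vector of a \<open>k\<close>-independent set \<open>S\<close>, positivity of the form on
  the component of \<open>x\<close> orthogonal to \<open>e\<close> gives \<open>x\<^sup>T M x \<ge> (p(\<lambda>\<^sub>1) - \<lambda>) |S|\<^sup>2 / n\<close>. Entries of \<open>A\<^sup>m\<close> count
  walks of length \<open>m\<close>, so \<open>p(A)\<close> vanishes off the diagonal on \<open>S\<close> and \<open>x\<^sup>T M x \<le> |S| (W(p) - \<lambda>)\<close>.
\<close>

no_notation inner (infix "\<bullet>" 70)  \<comment> \<open>clashes with the scalar product of \<^typ>\<open>'a vec\<close>\<close>

section \<open>Scalar products and norm bounds over the reals\<close>

lemma smult_mat_mult_mat_vec:
  assumes "A \<in> carrier_mat nr nc" "v \<in> carrier_vec nc"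
  shows "(c \<cdot>\<^sub>m A) *\<^sub>v v = c \<cdot>\<^sub>v (A *\<^sub>v v)"
  using assms by (intro eq_vecI) (auto intro!: smult_scalar_prod_distrib[of _ nc] row_carrier_vec)

lemma scalar_prod_self_nonneg:
  fixes x :: "real vec"
  shows "0 \<le> x \<bullet> x"
  unfolding scalar_prod_def by (intro sum_nonneg) simp

lemma scalar_prod_self_pos:
  fixes x :: "real vec"
  assumes "x \<in> carrier_vec n" "x \<noteq> 0\<^sub>v n"
  shows "0 < x \<bullet> x"
proof -
  obtain i where "i < n" "x $ i \<noteq> 0"
    using assms by (metis carrier_vecD eq_vecI index_zero_vec)
  then show ?thesis
    using assms unfolding scalar_prod_def by (intro sum_pos2[of _ i]) auto
qed

text \<open>Cauchy-Schwarz on each row bounds the squared norm of the image through the squared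
  Frobenius norm of \<open>N\<close>. Adding 1 keeps the constant positive for \<open>N = 0\<close>,
  so that it can appear in a denominator.\<close>

lemma mult_mat_vec_bounded:
  fixes N :: "real mat"
  assumes N: "N \<in> carrier_mat m n"
  obtains K where "K > 0" "\<And>x. x \<in> carrier_vec n \<Longrightarrow> (N *\<^sub>v x) \<bullet> (N *\<^sub>v x) \<le> K * (x \<bullet> x)"
proof -
  define K where "K = (\<Sum>i=0..<m. \<Sum>j=0..<n. (N $$ (i, j))\<^sup>2)"
  have "(N *\<^sub>v x) \<bullet> (N *\<^sub>v x) \<le> (K + 1) * (x \<bullet> x)" if x: "x \<in> carrier_vec n" for x
  proof -
    have xx: "x \<bullet> x = (\<Sum>j=0..<n. (x $ j)\<^sup>2)"
      using x by (simp add: scalar_prod_def power2_eq_square)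
    have "(N *\<^sub>v x) \<bullet> (N *\<^sub>v x) = (\<Sum>i=0..<m. (\<Sum>j=0..<n. N $$ (i, j) * x $ j)\<^sup>2)"
      using x N by (simp add: scalar_prod_def power2_eq_square)
    also have "\<dots> \<le> (\<Sum>i=0..<m. (\<Sum>j=0..<n. (N $$ (i, j))\<^sup>2) * (x \<bullet> x))"
      unfolding xx by (intro sum_mono Cauchy_Schwarz_ineq_sum)
    also have "\<dots> = K * (x \<bullet> x)"
      by (simp add: K_def sum_distrib_right)
    also have "\<dots> \<le> (K + 1) * (x \<bullet> x)"
      using scalar_prod_self_nonneg[of x] by (simp add: algebra_simps)
    finally show ?thesis .
  qed
  moreover have "K + 1 > 0"
    unfolding K_def by (smt (verit) sum_nonneg zero_le_power2)
  ultimately show ?thesis using that by blast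
qed

lemma scalar_prod_mult_mat_vec_symmetric:
  fixes M :: "'a :: comm_ring_1 mat"
  assumes M: "M \<in> carrier_mat n n" and sym: "transpose_mat M = M"
    and x: "x \<in> carrier_vec n" and y: "y \<in> carrier_vec n"
  shows "x \<bullet> (M *\<^sub>v y) = (M *\<^sub>v x) \<bullet> y"
proof -
  have "M $$ (i, j) = M $$ (j, i)" if "i < n" "j < n" for i j
    using that M sym by (metis carrier_matD index_transpose_mat(1))
  then have "(\<Sum>i=0..<n. \<Sum>j=0..<n. x $ i * (M $$ (i, j) * y $ j))
      = (\<Sum>i=0..<n. \<Sum>j=0..<n. M $$ (j, i) * x $ i * y $ j)"
    by (intro sum.cong) (auto simp: mult_ac)
  also have "\<dots> = (\<Sum>j=0..<n. \<Sum>i=0..<n. M $$ (j, i) * x $ i * y $ j)"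
    by (rule sum.swap)
  finally show ?thesis
    using M x y by (simp add: scalar_prod_def sum_distrib_left sum_distrib_right)
qed

text \<open>Evaluate the form at \<open>x - s B x\<close> for a small \<open>s\<close>.\<close>

lemma norm_mult_le_psd_form:
  fixes B :: "real mat"
  assumes B: "B \<in> carrier_mat n n" and sym: "transpose_mat B = B"
    and psd: "\<And>x. x \<in> carrier_vec n \<Longrightarrow> 0 \<le> x \<bullet> (B *\<^sub>v x)"
  obtains K where "K > 0"
    "\<And>x. x \<in> carrier_vec n \<Longrightarrow> (B *\<^sub>v x) \<bullet> (B *\<^sub>v x) \<le> K * (x \<bullet> (B *\<^sub>v x))"
proof -
  obtain L where L: "L > 0"
    "\<And>x. x \<in> carrier_vec n \<Longrightarrow> (B *\<^sub>v x) \<bullet> (B *\<^sub>v x) \<le> L * (x \<bullet> x)"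
    using mult_mat_vec_bounded[OF B] by blast
  \<comment> \<open>Expanding the squared norm of \<open>x - B *\<^sub>v x\<close> bounds the form
    from above without square roots.\<close>
  have form_le: "x \<bullet> (B *\<^sub>v x) \<le> (L + 1) / 2 * (x \<bullet> x)" if x: "x \<in> carrier_vec n" for x
  proof -
    have Bx: "B *\<^sub>v x \<in> carrier_vec n" using B x by simp
    have "0 \<le> (x - B *\<^sub>v x) \<bullet> (x - B *\<^sub>v x)" by (rule scalar_prod_self_nonneg)
    also have "\<dots> = x \<bullet> x - 2 * (x \<bullet> (B *\<^sub>v x)) + (B *\<^sub>v x) \<bullet> (B *\<^sub>v x)"
      using x Bx by (simp add: scalar_prod_minus_distrib[of _ n] minus_scalar_prod_distrib[of _ n]
          comm_scalar_prod[of "B *\<^sub>v x" n x])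
    finally show ?thesis using L(2)[OF x] by (simp add: field_simps)
  qed
  have "(B *\<^sub>v x) \<bullet> (B *\<^sub>v x) \<le> (L + 1) / 2 * (x \<bullet> (B *\<^sub>v x))" if x: "x \<in> carrier_vec n" for x
  proof -
    define y where "y = B *\<^sub>v x"
    define K where "K = (L + 1) / 2"
    have K: "K > 0" using L by (simp add: K_def)
    have y: "y \<in> carrier_vec n" using B x by (simp add: y_def)
    \<comment> \<open>The coefficient \<open>- 2 * s + s * s * K\<close> of
      \<open>y \<bullet> y\<close> in the estimate below is least at this \<open>s\<close>, where it
      equals \<open>- 1 / K\<close>.\<close>
    define s where "s = 1 / K"
    have By: "B *\<^sub>v y \<in> carrier_vec n" using B y by simp
    have xBy: "x \<bullet> (B *\<^sub>v y) = y \<bullet> y"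
      unfolding y_def using scalar_prod_mult_mat_vec_symmetric[OF B sym x] y
      by (simp add: y_def)
    have "0 \<le> (x - s \<cdot>\<^sub>v y) \<bullet> (B *\<^sub>v (x - s \<cdot>\<^sub>v y))"
      using x y by (intro psd) simp
    also have "B *\<^sub>v (x - s \<cdot>\<^sub>v y) = y - s \<cdot>\<^sub>v (B *\<^sub>v y)"
      using x y B by (simp add: mult_minus_distrib_mat_vec[of _ n n] mult_mat_vec[of _ n n] y_def)
    also have "(x - s \<cdot>\<^sub>v y) \<bullet> (y - s \<cdot>\<^sub>v (B *\<^sub>v y))
        = x \<bullet> y - 2 * s * (y \<bullet> y) + s * s * (y \<bullet> (B *\<^sub>v y))"
      using x y By
      by (simp add: scalar_prod_minus_distrib[of _ n] minus_scalar_prod_distrib[of _ n] xBy)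
    also have "\<dots> \<le> x \<bullet> y - 2 * s * (y \<bullet> y) + s * s * (K * (y \<bullet> y))"
      using mult_left_mono[OF form_le[OF y], of "s * s"] by (simp add: K_def)
    also have "\<dots> = x \<bullet> y - (y \<bullet> y) / K"
      using K by (simp add: s_def field_simps)
    finally show ?thesis using K by (simp add: field_simps y_def K_def)
  qed
  then show ?thesis using that[of "(L + 1) / 2"] L(1) by simp
qed

section \<open>Positive semidefiniteness from nonnegative eigenvalues\<close>

text \<open>A Rayleigh quotient argument that avoids finding a minimiser. If the form is negative
  somewhere, its infimum \<open>t\<close> over unit vectors is negative, hence not an eigenvalue.
  Then \<open>B\<close>, which is \<open>M\<close> minus \<open>t\<close> times the identity, is
  positive semidefinite and invertible. Invertibility keeps \<open>B *\<^sub>v y\<close> away from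
  zero on the unit sphere, \<open>norm_mult_le_psd_form\<close> carries this over to the form of
  \<open>B\<close>, and so the form of \<open>M\<close> stays above \<open>t\<close> by a fixed
  amount: a contradiction.\<close>

lemma symmetric_psd_if_eigenvalues_nonneg:
  fixes M :: "real mat"
  assumes M: "M \<in> carrier_mat n n" and sym: "transpose_mat M = M"
    and ev: "\<And>\<mu>. eigenvalue M \<mu> \<Longrightarrow> 0 \<le> \<mu>"
    and x: "x \<in> carrier_vec n"
  shows "0 \<le> x \<bullet> (M *\<^sub>v x)"
proof (rule ccontr)
  assume neg: "\<not> ?thesis"
  define S where "S = {y \<bullet> (M *\<^sub>v y) | y. y \<in> carrier_vec n \<and> y \<bullet> y = 1}"
  define t where "t = Inf S"
  have unit: "\<exists>z \<in> carrier_vec n. z \<bullet> z = 1 \<and> y \<bullet> (M *\<^sub>v y) = (y \<bullet> y) * (z \<bullet> (M *\<^sub>v z))"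
    if y: "y \<in> carrier_vec n" "y \<noteq> 0\<^sub>v n" for y
  proof -
    define r where "r = sqrt (y \<bullet> y)"
    have r: "r > 0" "r * r = y \<bullet> y" using scalar_prod_self_pos[OF y] by (auto simp: r_def)
    define z where "z = (1 / r) \<cdot>\<^sub>v y"
    have z: "z \<in> carrier_vec n" using y by (simp add: z_def)
    have "y = r \<cdot>\<^sub>v z" using r y by (simp add: z_def smult_smult_assoc)
    have "z \<bullet> z = 1" using r(1) y by (simp add: z_def flip: r(2))
    moreover have "y \<bullet> (M *\<^sub>v y) = (r * r) * (z \<bullet> (M *\<^sub>v z))"
      using z M by (simp add: \<open>y = r \<cdot>\<^sub>v z\<close> mult_mat_vec[of _ n n])
    ultimately show ?thesis using z r(2) by auto
  qed
  obtain L where L: "L > 0"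
    "\<And>x. x \<in> carrier_vec n \<Longrightarrow> (M *\<^sub>v x) \<bullet> (M *\<^sub>v x) \<le> L * (x \<bullet> x)"
    using mult_mat_vec_bounded[OF M] by blast
  have bdd: "bdd_below S"
  proof (rule bdd_belowI)
    fix s assume "s \<in> S"
    then obtain y where y: "y \<in> carrier_vec n" "y \<bullet> y = 1" and s: "s = y \<bullet> (M *\<^sub>v y)"
      by (auto simp: S_def)
    have My: "M *\<^sub>v y \<in> carrier_vec n" using M y by simp
    \<comment> \<open>The cross term of this square is \<open>2 * s\<close>, and the other two terms
      are at most \<open>1 + L\<close>.\<close>
    have "0 \<le> (y + M *\<^sub>v y) \<bullet> (y + M *\<^sub>v y)" by (rule scalar_prod_self_nonneg)
    also have "\<dots> = y \<bullet> y + 2 * s + (M *\<^sub>v y) \<bullet> (M *\<^sub>v y)"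
      using y My by (simp add: s scalar_prod_add_distrib[of _ n] add_scalar_prod_distrib[of _ n]
          comm_scalar_prod[of "M *\<^sub>v y" n y])
    finally show "- (1 + L) / 2 \<le> s" using L(2)[OF y(1)] y(2) by simp
  qed
  have "x \<noteq> 0\<^sub>v n" using neg M by auto
  then obtain z where z: "z \<in> carrier_vec n" "z \<bullet> z = 1"
    "x \<bullet> (M *\<^sub>v x) = (x \<bullet> x) * (z \<bullet> (M *\<^sub>v z))"
    using unit[OF x] by blast
  have zS: "z \<bullet> (M *\<^sub>v z) \<in> S" using z by (auto simp: S_def)
  have "z \<bullet> (M *\<^sub>v z) < 0"
    using neg z(3) scalar_prod_self_nonneg[of x] by (simp add: not_le mult_less_0_iff)
  then have "t < 0"
    using cInf_lower[OF zS bdd] by (simp add: t_def)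
  then have "\<not> eigenvalue M t" using ev by force
  define B where "B = M - t \<cdot>\<^sub>m 1\<^sub>m n"
  have B: "B \<in> carrier_mat n n" unfolding B_def using M by (intro minus_carrier_mat) auto
  have Bv: "B *\<^sub>v y = M *\<^sub>v y - t \<cdot>\<^sub>v y" if y: "y \<in> carrier_vec n" for y
  proof -
    have "(t \<cdot>\<^sub>m 1\<^sub>m n) *\<^sub>v y = t \<cdot>\<^sub>v (1\<^sub>m n *\<^sub>v y)"
      using y by (intro smult_mat_mult_mat_vec) auto
    then show ?thesis
      unfolding B_def using M y by (subst minus_mult_distrib_mat_vec[of _ n n]) auto
  qed
  have form: "y \<bullet> (B *\<^sub>v y) = y \<bullet> (M *\<^sub>v y) - t * (y \<bullet> y)" if y: "y \<in> carrier_vec n" for y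
    using y M by (simp add: Bv scalar_prod_minus_distrib[of _ n])
  have symB: "transpose_mat B = B"
    unfolding B_def using M sym
    by (intro eq_matI) (auto, metis carrier_matD index_transpose_mat(1))
  have psdB: "0 \<le> y \<bullet> (B *\<^sub>v y)" if y: "y \<in> carrier_vec n" for y
  proof (cases "y = 0\<^sub>v n")
    case True
    then show ?thesis using B by simp
  next
    case False
    then obtain w where w: "w \<in> carrier_vec n" "w \<bullet> w = 1"
      "y \<bullet> (M *\<^sub>v y) = (y \<bullet> y) * (w \<bullet> (M *\<^sub>v w))"
      using unit[OF y] by blast
    have "t \<le> w \<bullet> (M *\<^sub>v w)" unfolding t_def using bdd w by (intro cInf_lower) (auto simp: S_def)
    then have "(y \<bullet> y) * t \<le> (y \<bullet> y) * (w \<bullet> (M *\<^sub>v w))"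
      using scalar_prod_self_nonneg by (rule mult_left_mono)
    then show ?thesis using y w by (simp add: form mult.commute)
  qed
  have "det B \<noteq> 0"
  proof
    assume "det B = 0"
    then obtain v where v: "v \<in> carrier_vec n" "v \<noteq> 0\<^sub>v n" "B *\<^sub>v v = 0\<^sub>v n"
      using det_0_iff_vec_prod_zero[OF B] by blast
    then have "M *\<^sub>v v - t \<cdot>\<^sub>v v = 0\<^sub>v n" using Bv by simp
    then have "M *\<^sub>v v = t \<cdot>\<^sub>v v"
      using v M by (intro eq_vecI) (auto simp: vec_eq_iff)
    then have "eigenvalue M t" unfolding eigenvalue_def eigenvector_def using v M by auto
    with \<open>\<not> eigenvalue M t\<close> show False ..
  qed
  then have "B \<in> Units (ring_mat TYPE(real) n ())" by (rule det_non_zero_imp_unit[OF B])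
  then obtain N where N: "N \<in> carrier_mat n n" "N * B = 1\<^sub>m n"
    unfolding Units_def ring_mat_def by auto
  obtain C where C: "C > 0"
    "\<And>y. y \<in> carrier_vec n \<Longrightarrow> (N *\<^sub>v y) \<bullet> (N *\<^sub>v y) \<le> C * (y \<bullet> y)"
    using mult_mat_vec_bounded[OF N(1)] by blast
  obtain K where K: "K > 0"
    "\<And>y. y \<in> carrier_vec n \<Longrightarrow> (B *\<^sub>v y) \<bullet> (B *\<^sub>v y) \<le> K * (y \<bullet> (B *\<^sub>v y))"
    using norm_mult_le_psd_form[OF B symB psdB] by blast
  \<comment> \<open>The gap comes from \<open>1 = y \<bullet> y\<close>, which is at most
    \<open>C\<close> times the squared norm of \<open>B *\<^sub>v y\<close>, hence at most
    \<open>C * K * (s - t)\<close>.\<close>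
  have "t + 1 / (C * K) \<le> Inf S"
  proof (rule cInf_greatest)
    show "S \<noteq> {}" using zS by auto
    fix s assume "s \<in> S"
    then obtain y where y: "y \<in> carrier_vec n" "y \<bullet> y = 1" and s: "s = y \<bullet> (M *\<^sub>v y)"
      by (auto simp: S_def)
    have "N *\<^sub>v (B *\<^sub>v y) = y"
      using assoc_mult_mat_vec[OF N(1) B y(1)] N(2) y(1) by simp
    then have "1 \<le> C * ((B *\<^sub>v y) \<bullet> (B *\<^sub>v y))"
      using C(2)[of "B *\<^sub>v y"] B y by simp
    also have "\<dots> \<le> C * (K * (y \<bullet> (B *\<^sub>v y)))"
      using C(1) K(2)[OF y(1)] by simp
    also have "\<dots> = C * K * (s - t)" using y by (simp add: form s)
    finally show "t + 1 / (C * K) \<le> s"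
      using C(1) K(1) by (simp add: field_simps)
  qed
  then show False using mult_pos_pos[OF C(1) K(1)] by (simp add: t_def)
qed

section \<open>Polynomials in a matrix and their eigenvalues\<close>

text \<open>The formula of \<open>poly_mat\<close> over any commutative ring, because the
  eigenvalues of a real matrix polynomial are found by passing to complex matrices.\<close>

definition mat_poly :: "'a :: comm_ring_1 poly \<Rightarrow> 'a mat \<Rightarrow> 'a mat" where
  "mat_poly f A = mat (dim_row A) (dim_row A)
     (\<lambda>(i, j). \<Sum>m\<le>degree f. coeff f m * (A ^\<^sub>m m) $$ (i, j))"

lemma poly_mat_eq_mat_poly: "poly_mat = mat_poly"
  by (intro ext) (simp add: poly_mat_def mat_poly_def)

lemma dim_mat_poly [simp]: "dim_row (mat_poly f A) = dim_row A" "dim_col (mat_poly f A) = dim_row A"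
  by (simp_all add: mat_poly_def)

lemma mat_poly_carrier [simp]: "A \<in> carrier_mat n n \<Longrightarrow> mat_poly f A \<in> carrier_mat n n"
  by (simp add: mat_poly_def)

text \<open>A free cutoff \<open>N\<close> above the degree lets polynomials of different degrees be
  compared term by term, and later puts \<open>k\<close> in place of the degree.\<close>

lemma index_mat_poly:
  assumes "A \<in> carrier_mat n n" "degree f \<le> N" "i < n" "j < n"
  shows "mat_poly f A $$ (i, j) = (\<Sum>m\<le>N. coeff f m * (A ^\<^sub>m m) $$ (i, j))"
proof -
  have "mat_poly f A $$ (i, j) = (\<Sum>m\<le>degree f. coeff f m * (A ^\<^sub>m m) $$ (i, j))"
    using assms by (simp add: mat_poly_def)
  also have "\<dots> = (\<Sum>m\<le>N. coeff f m * (A ^\<^sub>m m) $$ (i, j))"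
    using assms by (intro sum.mono_neutral_left) (auto simp: coeff_eq_0)
  finally show ?thesis .
qed

lemma mat_poly_const:
  assumes "A \<in> carrier_mat n n"
  shows "mat_poly [:c:] A = c \<cdot>\<^sub>m 1\<^sub>m n"
  using assms by (intro eq_matI) (auto simp: mat_poly_def)

lemma mat_poly_diff:
  assumes A: "A \<in> carrier_mat n n"
  shows "mat_poly (f - g) A = mat_poly f A - mat_poly g A"
proof (rule eq_matI)
  fix i j assume "i < dim_row (mat_poly f A - mat_poly g A)" "j < dim_col (mat_poly f A - mat_poly g A)"
  then have ij: "i < n" "j < n" using mat_poly_carrier[OF A, of g] by auto
  let ?N = "max (degree f) (degree g)"
  have "degree (f - g) \<le> ?N" by (rule degree_diff_le_max)
  then show "mat_poly (f - g) A $$ (i, j) = (mat_poly f A - mat_poly g A) $$ (i, j)"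
    using ij A
    by (simp add: index_mat_poly[OF A _ ij, of _ ?N] sum_subtractf left_diff_distrib)
qed (use A in \<open>simp_all add: mat_poly_def\<close>)

lemma mat_poly_smult:
  assumes A: "A \<in> carrier_mat n n"
  shows "mat_poly (Polynomial.smult c f) A = c \<cdot>\<^sub>m mat_poly f A"
proof (rule eq_matI)
  fix i j assume "i < dim_row (c \<cdot>\<^sub>m mat_poly f A)" "j < dim_col (c \<cdot>\<^sub>m mat_poly f A)"
  then have ij: "i < n" "j < n" using mat_poly_carrier[OF A, of f] by auto
  then show "mat_poly (Polynomial.smult c f) A $$ (i, j) = (c \<cdot>\<^sub>m mat_poly f A) $$ (i, j)"
    using A ij Polynomial.degree_smult_le[of c f]
    by (simp add: index_mat_poly[OF A _ ij, of _ "degree f"] sum_distrib_left mult.assoc)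
qed (use A in \<open>simp_all add: mat_poly_def\<close>)

lemma mat_poly_pCons_0:
  assumes A: "A \<in> carrier_mat n n"
  shows "mat_poly (pCons 0 f) A = mat_poly f A * A"
proof (rule eq_matI)
  fix i j assume "i < dim_row (mat_poly f A * A)" "j < dim_col (mat_poly f A * A)"
  then have ij: "i < n" "j < n" using A mat_poly_carrier[OF A, of f] by auto
  have "(mat_poly f A * A) $$ (i, j) = (\<Sum>l=0..<n. mat_poly f A $$ (i, l) * A $$ (l, j))"
    using ij A mat_poly_carrier[OF A, of f] by (simp add: scalar_prod_def)
  also have "\<dots> = (\<Sum>l=0..<n. \<Sum>m\<le>degree f. coeff f m * ((A ^\<^sub>m m) $$ (i, l) * A $$ (l, j)))"
    using ij by (simp add: index_mat_poly[OF A order_refl] sum_distrib_right mult.assoc)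
  also have "\<dots> = (\<Sum>m\<le>degree f. \<Sum>l=0..<n. coeff f m * ((A ^\<^sub>m m) $$ (i, l) * A $$ (l, j)))"
    by (rule sum.swap)
  also have "\<dots> = (\<Sum>m\<le>degree f. coeff f m * (A ^\<^sub>m Suc m) $$ (i, j))"
    using ij A by (simp add: scalar_prod_def sum_distrib_left)
  also have "\<dots> = (\<Sum>m\<le>Suc (degree f). coeff (pCons 0 f) m * (A ^\<^sub>m m) $$ (i, j))"
    by (subst sum.atMost_Suc_shift) simp
  also have "\<dots> = mat_poly (pCons 0 f) A $$ (i, j)"
    by (rule index_mat_poly[symmetric, OF A degree_pCons_le ij])
  finally show "mat_poly (pCons 0 f) A $$ (i, j) = (mat_poly f A * A) $$ (i, j)" ..
qed (use A in \<open>simp_all add: mat_poly_def\<close>)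

text \<open>Peels off a linear factor and lets it act on the vector first. The resulting vector
  vanishes for an eigenvector; otherwise it serves as the next vector in an induction on the
  degree.\<close>

lemma mat_poly_linear_factor_mult_vec:
  fixes A :: "'a :: field mat"
  assumes A: "A \<in> carrier_mat n n" and v: "v \<in> carrier_vec n"
  shows "mat_poly ([:- r, 1:] * g) A *\<^sub>v v = mat_poly g A *\<^sub>v (A *\<^sub>v v - r \<cdot>\<^sub>v v)"
proof -
  have g: "mat_poly g A \<in> carrier_mat n n" using A by simp
  have "[:- r, 1:] * g = pCons 0 g - Polynomial.smult r g" by simp
  then have "mat_poly ([:- r, 1:] * g) A = mat_poly g A * A - r \<cdot>\<^sub>m mat_poly g A"
    using A by (simp only: mat_poly_diff mat_poly_pCons_0 mat_poly_smult)
  moreover have "mat_poly g A * A \<in> carrier_mat n n" by (rule mult_carrier_mat[OF g A])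
  ultimately show ?thesis
    using minus_mult_distrib_mat_vec[of "mat_poly g A * A" n n "r \<cdot>\<^sub>m mat_poly g A" v]
      mult_minus_distrib_mat_vec[OF g, of "A *\<^sub>v v" "r \<cdot>\<^sub>v v"] A v g
    by (simp add: smult_mat_mult_mat_vec[OF g v] mult_mat_vec[OF g v])
qed

lemma (in comm_ring_hom) mat_poly_hom:
  assumes A: "A \<in> carrier_mat n n"
  shows "mat_poly (map_poly hom f) (map_mat hom A) = map_mat hom (mat_poly f A)"
proof (rule eq_matI)
  fix i j assume "i < dim_row (map_mat hom (mat_poly f A))" "j < dim_col (map_mat hom (mat_poly f A))"
  then have ij: "i < n" "j < n" using mat_poly_carrier[OF A, of f] by auto
  have "degree (map_poly hom f) \<le> degree f" by (rule degree_map_poly_le)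
  then have "mat_poly (map_poly hom f) (map_mat hom A) $$ (i, j)
      = (\<Sum>m\<le>degree f. coeff (map_poly hom f) m * (map_mat hom A ^\<^sub>m m) $$ (i, j))"
    using A ij by (intro index_mat_poly) auto
  also have "\<dots> = hom (mat_poly f A $$ (i, j))"
    using A ij by (simp add: index_mat_poly[OF A order_refl] hom_distribs flip: mat_hom_pow)
  finally show "mat_poly (map_poly hom f) (map_mat hom A) $$ (i, j) = map_mat hom (mat_poly f A) $$ (i, j)"
    using ij A by simp
qed (use A in \<open>simp_all add: mat_poly_def\<close>)

text \<open>By the factor theorem \<open>f - [:poly f r:]\<close> has the factor
  \<open>[:- r, 1:]\<close>, which at \<open>A\<close> sends \<open>v\<close> to zero.\<close>

lemma mat_poly_eigenvector:
  fixes A :: "'a :: field mat"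
  assumes A: "A \<in> carrier_mat n n" and v: "eigenvector A v r"
  shows "mat_poly f A *\<^sub>v v = poly f r \<cdot>\<^sub>v v"
proof -
  have v': "v \<in> carrier_vec n" and Av: "A *\<^sub>v v = r \<cdot>\<^sub>v v"
    using v A by (auto simp: eigenvector_def)
  have "[:- r, 1:] dvd f - [:poly f r:]"
    by (simp add: poly_eq_0_iff_dvd[symmetric])
  then obtain g where g: "f - [:poly f r:] = [:- r, 1:] * g" by (elim dvdE)
  have gA: "mat_poly g A \<in> carrier_mat n n" "mat_poly f A \<in> carrier_mat n n" using A by auto
  have "mat_poly (f - [:poly f r:]) A *\<^sub>v v = mat_poly g A *\<^sub>v (r \<cdot>\<^sub>v v - r \<cdot>\<^sub>v v)"
    unfolding g mat_poly_linear_factor_mult_vec[OF A v'] Av ..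
  also have "\<dots> = 0\<^sub>v n" using gA v' by (intro eq_vecI) auto
  finally have "mat_poly f A *\<^sub>v v - poly f r \<cdot>\<^sub>v v = 0\<^sub>v n"
    using gA v' by (simp add: mat_poly_diff[OF A] mat_poly_const[OF A]
        minus_mult_distrib_mat_vec[of _ n n] smult_mat_mult_mat_vec[of _ n n])
  then show ?thesis
    using v' gA by (intro eq_vecI) (auto simp: vec_eq_iff)
qed

text \<open>A nonconstant \<open>f\<close> has a complex root \<open>r\<close>. Either
  \<open>v\<close> is an eigenvector for \<open>r\<close>, or the cofactor, of smaller degree,
  annihilates the nonzero vector \<open>A *\<^sub>v v - r \<cdot>\<^sub>v v\<close>. A nonzero
  constant annihilates no nonzero vector, so the descent must meet an eigenvalue.\<close>

lemma mat_poly_annihilates_imp_eigenvalue_root: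
  fixes A :: "complex mat"
  assumes A: "A \<in> carrier_mat n n"
  shows "f \<noteq> 0 \<Longrightarrow> v \<in> carrier_vec n \<Longrightarrow> v \<noteq> 0\<^sub>v n \<Longrightarrow> mat_poly f A *\<^sub>v v = 0\<^sub>v n
    \<Longrightarrow> \<exists>r. poly f r = 0 \<and> eigenvalue A r"
proof (induction "degree f" arbitrary: f v)
  case 0
  then obtain c where "f = [:c:]" "c \<noteq> 0" by (metis degree_0_id pCons_0_0)
  then have "c \<cdot>\<^sub>v v = 0\<^sub>v n"
    using 0 by (simp add: mat_poly_const[OF A] smult_mat_mult_mat_vec[of _ n n])
  then have "v = 0\<^sub>v n" using \<open>c \<noteq> 0\<close> \<open>v \<in> carrier_vec n\<close> by (auto simp: vec_eq_iff)
  then show ?case using 0 by simp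
next
  case (Suc d)
  have "\<not> constant (poly f)" using Suc.hyps by (simp add: constant_degree)
  then obtain r where r: "poly f r = 0" using fundamental_theorem_of_algebra by blast
  then obtain g where g: "f = [:- r, 1:] * g" by (metis dvdE poly_eq_0_iff_dvd)
  define w where "w = A *\<^sub>v v - r \<cdot>\<^sub>v v"
  have w: "w \<in> carrier_vec n" using Suc.prems A by (simp add: w_def)
  show ?case
  proof (cases "w = 0\<^sub>v n")
    case True
    then have "A *\<^sub>v v = r \<cdot>\<^sub>v v"
      using A Suc.prems unfolding w_def by (intro eq_vecI) (auto simp: vec_eq_iff)
    then show ?thesis using r A Suc.prems unfolding eigenvalue_def eigenvector_def by auto
  next
    case False
    have "g \<noteq> 0" using g Suc.prems by auto
    then have "degree f = Suc (degree g)" unfolding g by (subst degree_mult_eq) auto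
    then have "d = degree g" using Suc.hyps by simp
    moreover have "mat_poly g A *\<^sub>v w = 0\<^sub>v n"
      using Suc.prems(4) unfolding g mat_poly_linear_factor_mult_vec[OF A Suc.prems(2)] w_def .
    ultimately obtain s where "poly g s = 0" "eigenvalue A s"
      using Suc.hyps(1)[of g w] \<open>g \<noteq> 0\<close> w False by auto
    then show ?thesis unfolding g by auto
  qed
qed

text \<open>The Hermitian form \<open>h\<close> at an eigenvector \<open>w\<close> is
  \<open>r\<close> times the squared norm of \<open>w\<close>, and symmetry of the real matrix makes
  \<open>h\<close> its own conjugate. Dividing by the positive norm shows that \<open>r\<close> is
  real.\<close>

lemma symmetric_real_mat_complex_eigenvalue:
  fixes A :: "real mat"
  assumes A: "A \<in> carrier_mat n n" and sym: "transpose_mat A = A"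
    and ev: "eigenvalue (map_mat complex_of_real A) r"
  shows "r \<in> \<real>"
proof -
  obtain w where w: "w \<in> carrier_vec n" "w \<noteq> 0\<^sub>v n"
    and Aw: "map_mat complex_of_real A *\<^sub>v w = r \<cdot>\<^sub>v w"
    using ev A unfolding eigenvalue_def eigenvector_def by auto
  define h where "h = (\<Sum>i=0..<n. \<Sum>j=0..<n. complex_of_real (A $$ (i, j)) * w $ j * cnj (w $ i))"
  define N where "N = (\<Sum>i=0..<n. (cmod (w $ i))\<^sup>2)"
  have symA: "A $$ (i, j) = A $$ (j, i)" if "i < n" "j < n" for i j
    using that A sym by (metis carrier_matD index_transpose_mat(1))
  have row: "(\<Sum>j=0..<n. complex_of_real (A $$ (i, j)) * w $ j) = r * w $ i" if "i < n" for i
  proof -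
    have "(map_mat complex_of_real A *\<^sub>v w) $ i = (r \<cdot>\<^sub>v w) $ i" by (simp only: Aw)
    then show ?thesis using that A w by (simp add: scalar_prod_def)
  qed
  have "h = (\<Sum>i=0..<n. r * (w $ i * cnj (w $ i)))"
    unfolding h_def by (intro sum.cong) (simp_all add: row flip: sum_distrib_right)
  also have "\<dots> = r * of_real N"
    by (simp add: N_def sum_distrib_left complex_norm_square del: of_real_power)
  finally have h: "h = r * of_real N" .
  have "cnj h = (\<Sum>i=0..<n. \<Sum>j=0..<n. complex_of_real (A $$ (j, i)) * w $ i * cnj (w $ j))"
    unfolding h_def by (auto simp: symA mult_ac intro!: sum.cong)
  also have "\<dots> = h" unfolding h_def by (rule sum.swap)
  finally have "h \<in> \<real>" by (simp add: Reals_cnj_iff)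
  have "N > 0"
  proof -
    obtain i where "i < n" "w $ i \<noteq> 0" using w by (metis carrier_vecD eq_vecI index_zero_vec)
    then show ?thesis unfolding N_def by (intro sum_pos2[of _ i]) auto
  qed
  then have "r = h / of_real N" using h by simp
  then show ?thesis using \<open>h \<in> \<real>\<close> by simp
qed

text \<open>Over the complex numbers, \<open>f\<close> minus the constant \<open>\<mu>\<close>,
  taken at \<open>A\<close>, annihilates the eigenvector of \<open>mat_poly f A\<close>, so one of
  its roots is an eigenvalue of \<open>A\<close>. Symmetry makes this root real.\<close>

lemma eigenvalue_mat_poly_symmetric:
  fixes A :: "real mat"
  assumes A: "A \<in> carrier_mat n n" and sym: "transpose_mat A = A"
    and ev: "eigenvalue (mat_poly f A) \<mu>"
  obtains \<theta> where "eigenvalue A \<theta>" "poly f \<theta> = \<mu>"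
proof -
  let ?A = "map_mat complex_of_real A"
  have cA: "?A \<in> carrier_mat n n" using A by simp
  obtain v where v: "eigenvector (mat_poly f A) v \<mu>" using ev by (auto simp: eigenvalue_def)
  have fA: "mat_poly f A \<in> carrier_mat n n" using A by simp
  have "eigenvector (map_mat of_real (mat_poly f A)) (map_vec of_real v) (complex_of_real \<mu>)"
    using of_real_hom.eigenvector_hom[OF fA v] .
  then have cv: "map_vec complex_of_real v \<in> carrier_vec n" "map_vec complex_of_real v \<noteq> 0\<^sub>v n"
    "mat_poly (map_poly of_real f) ?A *\<^sub>v map_vec of_real v = of_real \<mu> \<cdot>\<^sub>v map_vec of_real v"
    using fA by (auto simp: eigenvector_def of_real_hom.mat_poly_hom[OF A])
  define g where "g = map_poly complex_of_real f - [:of_real \<mu>:]"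
  have "\<exists>r. poly g r = 0 \<and> eigenvalue ?A r"
  proof (cases "g = 0")
    \<comment> \<open>Here \<open>f\<close> is the constant \<open>\<mu>\<close>, and any complex
      eigenvalue of \<open>A\<close> will do; one exists since \<open>n\<close> is positive.\<close>
    case True
    have "n \<noteq> 0" using cv by (metis carrier_vecD eq_vecI index_zero_vec not_less0)
    then have "\<not> constant (poly (char_poly ?A))"
      using degree_monic_char_poly[OF cA] by (simp add: constant_degree)
    then obtain r where "poly (char_poly ?A) r = 0" using fundamental_theorem_of_algebra by blast
    then show ?thesis using True eigenvalue_root_char_poly[OF cA] by auto
  next
    case False
    have "mat_poly g ?A *\<^sub>v map_vec of_real v = 0\<^sub>v n"
      using cv cA unfolding g_def
      by (simp add: mat_poly_diff[OF cA] mat_poly_const[OF cA]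
          minus_mult_distrib_mat_vec[of _ n n] smult_mat_mult_mat_vec[of _ n n])
    then show ?thesis using mat_poly_annihilates_imp_eigenvalue_root[OF cA False cv(1,2)] by blast
  qed
  then obtain r where r: "poly g r = 0" "eigenvalue ?A r" by blast
  then obtain \<theta> where \<theta>: "r = of_real \<theta>"
    using symmetric_real_mat_complex_eigenvalue[OF A sym] by (auto elim: Reals_cases)
  have "poly (char_poly A) \<theta> = 0"
    using r(2) by (simp add: eigenvalue_root_char_poly[OF cA] of_real_hom.char_poly_hom[OF A] \<theta>)
  moreover have "poly f \<theta> = \<mu>"
    using r(1) by (simp add: g_def \<theta>)
  ultimately show ?thesis using that eigenvalue_root_char_poly[OF A] by blast
qed

section \<open>Powers of the adjacency matrix and walks\<close>

context wf_digraph
begin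

text \<open>Instead of counting walks, the induction follows the support: a nonzero entry of the
  product has a nonzero summand \<open>l\<close>, and an arc from \<open>vs ! l\<close> to
  \<open>vs ! j\<close> extends a walk of length \<open>m\<close>.\<close>

lemma adjacency_matrix_pow_nonzero_imp_awalk:
  assumes "set vs = verts G" "i < length vs" "j < length vs"
    and "(adjacency_matrix G vs ^\<^sub>m m) $$ (i, j) \<noteq> 0"
  shows "\<exists>w. awalk (vs ! i) w (vs ! j) \<and> length w = m"
  using assms(3,4)
proof (induction m arbitrary: j)
  case 0
  then have "i = j"
    using assms(2) by (auto simp: adjacency_matrix_def split: if_splits)
  moreover have "vs ! i \<in> verts G" using assms by (metis nth_mem)
  ultimately show ?case by (auto simp: awalk_Nil_iff)
next
  case (Suc m)
  let ?A = "adjacency_matrix G vs"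
  have A: "?A \<in> carrier_mat (length vs) (length vs)" by (simp add: adjacency_matrix_def)
  have "(?A ^\<^sub>m Suc m) $$ (i, j) = (\<Sum>l=0..<length vs. (?A ^\<^sub>m m) $$ (i, l) * ?A $$ (l, j))"
    using A assms(2) Suc.prems(1) by (simp add: scalar_prod_def)
  with Suc.prems(2) obtain l where l: "l < length vs"
    "(?A ^\<^sub>m m) $$ (i, l) \<noteq> 0" "?A $$ (l, j) \<noteq> 0"
    by (metis (no_types, lifting) atLeastLessThan_iff mult_eq_0_iff sum.not_neutral_contains_not_neutral)
  obtain w where w: "awalk (vs ! i) w (vs ! l)" "length w = m"
    using Suc.IH[OF l(1,2)] by blast
  have "(vs ! l, vs ! j) \<in> arcs_ends G"
    using l(1,3) Suc.prems(1) by (auto simp: adjacency_matrix_def split: if_splits)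
  then obtain e where "e \<in> arcs G" "tail G e = vs ! l" "head G e = vs ! j" by blast
  then have "awalk (vs ! l) [e] (vs ! j)"
    using head_in_verts[of e] by (auto simp: awalk_simps)
  then have "awalk (vs ! i) (w @ [e]) (vs ! j)" using w by auto
  then show ?case using w(2) by (intro exI[of _ "w @ [e]"]) simp
qed

lemma adjacency_matrix_pow_eq_0:
  assumes "set vs = verts G" "i < length vs" "j < length vs"
    and "graph_dist G (vs ! i) (vs ! j) > ereal (real m)"
  shows "(adjacency_matrix G vs ^\<^sub>m m) $$ (i, j) = 0"
proof (rule ccontr)
  assume "\<not> ?thesis"
  then obtain w where w: "awalk (vs ! i) w (vs ! j)" "length w = m"
    using adjacency_matrix_pow_nonzero_imp_awalk[OF assms(1-3)] by blast
  \<comment> \<open>\<open>graph_dist\<close> is the infimum of the walk costs for unit arc costs,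
    where the cost of a walk is its length.\<close>
  have "awalk_cost (\<lambda>_. 1) w = real m"
    using w(2) by (simp add: awalk_cost_def sum_list_triv)
  then show False
    using min_cost_le_walk_cost[OF w(1), of "\<lambda>_. 1"] assms(4) by (simp add: graph_dist_def)
qed

end

section \<open>Row sums and the largest eigenvalue\<close>

lemma adjacency_matrix_carrier [simp]:
  "adjacency_matrix G vs \<in> carrier_mat (length vs) (length vs)"
  by (simp add: adjacency_matrix_def)

lemma index_adjacency_matrix:
  "i < length vs \<Longrightarrow> j < length vs
    \<Longrightarrow> adjacency_matrix G vs $$ (i, j) = (if (vs ! i, vs ! j) \<in> arcs_ends G then 1 else 0)"
  by (simp add: adjacency_matrix_def)

lemma (in sym_digraph) transpose_adjacency_matrix:
  "transpose_mat (adjacency_matrix G vs) = adjacency_matrix G vs"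
  using arcs_ends_symmetric[OF sym_arcs] by (intro eq_matI) (auto simp: adjacency_matrix_def)

text \<open>Positions adjacent to \<open>vs ! i\<close> correspond one to one to the arcs leaving
  it: \<open>vs\<close> has no repetitions, and there are no parallel arcs.\<close>

lemma (in digraph) sum_row_adjacency_matrix:
  assumes vs: "distinct vs" "set vs = verts G" and i: "i < length vs"
  shows "(\<Sum>j=0..<length vs. adjacency_matrix G vs $$ (i, j)) = real (out_degree G (vs ! i))"
proof -
  let ?J = "{j \<in> {0..<length vs}. (vs ! i, vs ! j) \<in> arcs_ends G}"
  have "(\<Sum>j=0..<length vs. adjacency_matrix G vs $$ (i, j)) = real (card ?J)"
    using i by (simp add: index_adjacency_matrix flip: sum.inter_filter)
  also have "card ?J = card (nth vs ` ?J)"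
    using vs by (intro card_image[symmetric]) (auto simp: inj_on_def nth_eq_iff_index_eq)
  also have "nth vs ` ?J = head G ` out_arcs G (vs ! i)"
  proof
    show "nth vs ` ?J \<subseteq> head G ` out_arcs G (vs ! i)"
      by (auto simp: arcs_ends_conv)
    show "head G ` out_arcs G (vs ! i) \<subseteq> nth vs ` ?J"
    proof
      fix v assume "v \<in> head G ` out_arcs G (vs ! i)"
      then obtain e where e: "e \<in> arcs G" "tail G e = vs ! i" "v = head G e" by auto
      then have "v \<in> set vs" using vs by simp
      then obtain j where j: "j < length vs" "v = vs ! j" by (metis in_set_conv_nth)
      moreover have "(vs ! i, vs ! j) \<in> arcs_ends G"
        using dominatesI[of e] e j by (simp add: arc_to_ends_def)
      ultimately show "v \<in> nth vs ` ?J" by auto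
    qed
  qed
  also have "card \<dots> = out_degree G (vs ! i)"
    unfolding out_degree_def
  proof (intro card_image inj_onI)
    fix e f assume "e \<in> out_arcs G (vs ! i)" "f \<in> out_arcs G (vs ! i)" "head G e = head G f"
    then show "e = f" by (intro no_multi_arcs) (auto simp: arc_to_ends_def)
  qed
  finally show ?thesis .
qed

text \<open>Compare the entry of largest modulus of an eigenvector with its row.\<close>

lemma eigenvalue_le_row_sum:
  fixes A :: "real mat"
  assumes A: "A \<in> carrier_mat n n"
    and nonneg: "\<And>i j. i < n \<Longrightarrow> j < n \<Longrightarrow> 0 \<le> A $$ (i, j)"
    and row: "\<And>i. i < n \<Longrightarrow> (\<Sum>j=0..<n. A $$ (i, j)) \<le> d"
    and ev: "eigenvalue A \<theta>"
  shows "\<theta> \<le> d"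
proof -
  obtain v where v: "v \<in> carrier_vec n" "v \<noteq> 0\<^sub>v n" and Av: "A *\<^sub>v v = \<theta> \<cdot>\<^sub>v v"
    using ev A by (auto simp: eigenvalue_def eigenvector_def)
  obtain k where k: "k < n" "v $ k \<noteq> 0"
    using v by (metis carrier_vecD eq_vecI index_zero_vec)
  define m where "m = Max ((\<lambda>i. \<bar>v $ i\<bar>) ` {0..<n})"
  have le: "\<bar>v $ j\<bar> \<le> m" if "j < n" for j using that unfolding m_def by (intro Max_ge) auto
  have "m \<in> (\<lambda>i. \<bar>v $ i\<bar>) ` {0..<n}" unfolding m_def using k by (intro Max_in) auto
  then obtain i where i: "i < n" "m = \<bar>v $ i\<bar>" by auto
  have "m > 0" using le[OF k(1)] k(2) by linarith
  have "(A *\<^sub>v v) $ i = (\<theta> \<cdot>\<^sub>v v) $ i" by (simp only: Av)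
  then have "(\<Sum>j=0..<n. A $$ (i, j) * v $ j) = \<theta> * v $ i"
    using A v i by (simp add: scalar_prod_def)
  then have "\<bar>\<theta>\<bar> * m = \<bar>\<Sum>j=0..<n. A $$ (i, j) * v $ j\<bar>" by (simp add: i(2) abs_mult)
  also have "\<dots> \<le> (\<Sum>j=0..<n. \<bar>A $$ (i, j) * v $ j\<bar>)" by (rule sum_abs)
  also have "\<dots> \<le> (\<Sum>j=0..<n. A $$ (i, j) * m)"
    using nonneg i(1) le by (intro sum_mono) (auto simp: abs_mult intro!: mult_mono)
  also have "\<dots> \<le> d * m"
    using row[OF i(1)] \<open>m > 0\<close> by (simp flip: sum_distrib_right)
  finally have "\<bar>\<theta>\<bar> \<le> d" using \<open>m > 0\<close> by simp
  then show ?thesis by simp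
qed

section \<open>The ordered list of eigenvalues\<close>

lemma set_eigenvalue_list:
  assumes A: "A \<in> carrier_mat n n"
  shows "set (eigenvalue_list A) = {\<theta>. eigenvalue A \<theta>}"
proof -
  have "char_poly A \<noteq> 0" using degree_monic_char_poly[OF A] by auto
  then show ?thesis
    by (auto simp: eigenvalue_list_def eigenvalue_root_char_poly[OF A] set_count_proots)
qed

text \<open>Places every entry of the list at an index up to \<open>n\<close>, the end of the range
  in \<open>min_poly_eigenvalue\<close>.\<close>

lemma length_eigenvalue_list:
  assumes A: "A \<in> carrier_mat n n"
  shows "length (eigenvalue_list A) \<le> n"
proof -
  have "size (proots (char_poly A)) \<le> degree (char_poly A)" by (rule size_proots_le)
  then show ?thesis
    using degree_monic_char_poly[OF A] by (simp add: eigenvalue_list_def flip: size_mset)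
qed

text \<open>The list is the reversal of an ascending one, so its head is the largest
  eigenvalue.\<close>

lemma nth_eigenvalue_1:
  assumes A: "A \<in> carrier_mat n n" and d: "eigenvalue A d"
    and max: "\<And>\<theta>. eigenvalue A \<theta> \<Longrightarrow> \<theta> \<le> d"
  shows "nth_eigenvalue A 1 = d"
proof -
  let ?L = "sorted_list_of_multiset (proots (char_poly A))"
  have L: "set ?L = {\<theta>. eigenvalue A \<theta>}"
    using set_eigenvalue_list[OF A] by (simp add: eigenvalue_list_def)
  then have "d \<in> set ?L" using d by blast
  then obtain i where i: "i < length ?L" "?L ! i = d" by (metis in_set_conv_nth)
  then have ne: "?L \<noteq> []" by auto
  have "?L ! i \<le> ?L ! (length ?L - 1)" using i(1) by (intro sorted_nth_mono) auto
  then have "d \<le> last ?L" using ne i(2) by (simp add: last_conv_nth)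
  moreover have "last ?L \<in> set ?L" using ne by (rule last_in_set)
  then have "last ?L \<le> d" using L max by blast
  ultimately have "last ?L = d" by simp
  moreover have "rev ?L ! 0 = last ?L" using ne by (simp add: hd_rev flip: hd_conv_nth)
  ultimately show ?thesis by (simp add: nth_eigenvalue_def eigenvalue_list_def)
qed

text \<open>The minimum leaves out index 1, and the gap hypothesis covers exactly that index. The
  lower bound therefore holds at every eigenvalue.\<close>

lemma min_poly_eigenvalue_le:
  assumes A: "A \<in> carrier_mat n n"
    and gap: "min_poly_eigenvalue A p \<le> poly p (nth_eigenvalue A 1)"
    and ev: "eigenvalue A \<theta>"
  shows "min_poly_eigenvalue A p \<le> poly p \<theta>"
proof -
  have "\<theta> \<in> set (eigenvalue_list A)" using ev set_eigenvalue_list[OF A] by simp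
  then obtain i where i: "i < length (eigenvalue_list A)" "eigenvalue_list A ! i = \<theta>"
    by (metis in_set_conv_nth)
  then have \<theta>: "\<theta> = nth_eigenvalue A (Suc i)" by (simp add: nth_eigenvalue_def)
  show ?thesis
  proof (cases "i = 0")
    case True
    then show ?thesis using gap \<theta> by simp
  next
    case False
    \<comment> \<open>List positions start at 0 and eigenvalue indices at 1, so a nonzero position
      has index at least 2.\<close>
    then have "Suc i \<in> {2..dim_row A}" using i length_eigenvalue_list[OF A] A by auto
    then show ?thesis unfolding min_poly_eigenvalue_def \<theta> by (intro Min_le) auto
  qed
qed

section \<open>Symmetry of matrix polynomials and the form along an eigenvector\<close>

text \<open>A power grows by a factor on the right, and transposition moves that factor to the left;
  commuting brings it back.\<close>

lemma pow_mat_mult_commute: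
  assumes A: "A \<in> carrier_mat n n"
  shows "A ^\<^sub>m m * A = A * A ^\<^sub>m m"
proof (induction m)
  case 0
  then show ?case using A by simp
next
  case (Suc m)
  have "A ^\<^sub>m Suc m * A = A * A ^\<^sub>m m * A" using Suc by simp
  also have "\<dots> = A * (A ^\<^sub>m m * A)" using A by (intro assoc_mult_mat) auto
  finally show ?case by simp
qed

lemma transpose_pow_mat_symmetric:
  fixes A :: "'a :: comm_ring_1 mat"
  assumes A: "A \<in> carrier_mat n n" and sym: "transpose_mat A = A"
  shows "transpose_mat (A ^\<^sub>m m) = A ^\<^sub>m m"
proof (induction m)
  case 0
  then show ?case by simp
next
  case (Suc m)
  have "transpose_mat (A ^\<^sub>m Suc m) = transpose_mat A * transpose_mat (A ^\<^sub>m m)"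
    using A by (simp add: transpose_mult[of _ n n _ n])
  then show ?case using Suc sym pow_mat_mult_commute[OF A] by simp
qed

lemma transpose_mat_poly_symmetric:
  assumes A: "A \<in> carrier_mat n n" and sym: "transpose_mat A = A"
  shows "transpose_mat (mat_poly f A) = mat_poly f A"
proof -
  have "(A ^\<^sub>m m) $$ (i, j) = (A ^\<^sub>m m) $$ (j, i)" if "i < n" "j < n" for i j m
    using that A transpose_pow_mat_symmetric[OF A sym, of m]
    by (metis index_transpose_mat(1) pow_mat_dim_square)
  then show ?thesis
    using A by (intro eq_matI) (auto simp: mat_poly_def intro!: sum.cong)
qed

text \<open>With this \<open>s\<close>, the vector \<open>x - s \<cdot>\<^sub>v e\<close> is the
  component of \<open>x\<close> orthogonal to \<open>e\<close>. The form there equals \<open>x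
  \<bullet> (M *\<^sub>v x) - c * (x \<bullet> e)\<^sup>2 / (e \<bullet> e)\<close>, which is
  nonnegative.\<close>

lemma psd_form_ge_eigenvector_part:
  fixes M :: "real mat"
  assumes M: "M \<in> carrier_mat n n" and sym: "transpose_mat M = M"
    and psd: "\<And>x. x \<in> carrier_vec n \<Longrightarrow> 0 \<le> x \<bullet> (M *\<^sub>v x)"
    and e: "eigenvector M e c" and x: "x \<in> carrier_vec n"
  shows "c * (x \<bullet> e)\<^sup>2 \<le> (e \<bullet> e) * (x \<bullet> (M *\<^sub>v x))"
proof -
  have e': "e \<in> carrier_vec n" "e \<noteq> 0\<^sub>v n" and Me: "M *\<^sub>v e = c \<cdot>\<^sub>v e"
    using e M by (auto simp: eigenvector_def)
  have pos: "0 < e \<bullet> e" by (rule scalar_prod_self_pos[OF e'])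
  define s where "s = (x \<bullet> e) / (e \<bullet> e)"
  have Mx: "M *\<^sub>v x \<in> carrier_vec n" using M x by simp
  have eMx: "e \<bullet> (M *\<^sub>v x) = c * (x \<bullet> e)"
    using scalar_prod_mult_mat_vec_symmetric[OF M sym e'(1) x] e' x
    by (simp add: Me comm_scalar_prod[of e n x])
  have "0 \<le> (x - s \<cdot>\<^sub>v e) \<bullet> (M *\<^sub>v (x - s \<cdot>\<^sub>v e))"
    using x e' by (intro psd) simp
  also have "M *\<^sub>v (x - s \<cdot>\<^sub>v e) = M *\<^sub>v x - (s * c) \<cdot>\<^sub>v e"
    using x e' M by (simp add: mult_minus_distrib_mat_vec[of _ n n] mult_mat_vec[of _ n n] Me
        smult_smult_assoc)
  also have "(x - s \<cdot>\<^sub>v e) \<bullet> (M *\<^sub>v x - (s * c) \<cdot>\<^sub>v e)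
      = x \<bullet> (M *\<^sub>v x) - 2 * s * c * (x \<bullet> e) + s * s * c * (e \<bullet> e)"
    using x e' Mx
    by (simp add: scalar_prod_minus_distrib[of _ n] minus_scalar_prod_distrib[of _ n] eMx)
      (simp add: algebra_simps)
  also have "\<dots> = x \<bullet> (M *\<^sub>v x) - c * (x \<bullet> e)\<^sup>2 / (e \<bullet> e)"
    using pos by (simp add: s_def field_simps power2_eq_square)
  finally show ?thesis using pos by (simp add: field_simps)
qed

text \<open>Singletons are independent, so the maximum ranges over a nonempty finite set and is
  positive. Positivity later allows one factor \<open>card S\<close> to be cancelled.\<close>

lemma k_independence_number_attained:
  assumes fin: "finite (verts G)" and ne: "verts G \<noteq> {}"
  obtains S where "k_independent G k S" "card S = k_independence_number G k" "0 < card S"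
proof -
  let ?C = "{card S | S. k_independent G k S}"
  have "?C \<subseteq> card ` Pow (verts G)" by (auto simp: k_independent_def)
  then have finC: "finite ?C" using fin by (meson finite_Pow_iff finite_imageI finite_subset)
  obtain v where "v \<in> verts G" using ne by blast
  then have "k_independent G k {v}" by (simp add: k_independent_def)
  then have 1: "1 \<in> ?C" by force
  then have "Max ?C \<in> ?C" using finC by (intro Max_in) auto
  then obtain S where "k_independent G k S" "card S = k_independence_number G k"
    by (auto simp: k_independence_number_def)
  moreover have "1 \<le> k_independence_number G k"
    unfolding k_independence_number_def using finC 1 by (rule Max_ge)
  ultimately show ?thesis using that by simp
qed

section \<open>The bound for a largest independent set\<close>

theorem theorem3p2:
  fixes G :: "('a, 'b) pre_digraph" and vs :: "'a list" and A :: "real mat"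
    and n k :: nat and p :: "real poly"
  assumes "regular_graph G"
    and "n = card (verts G)" and "n \<ge> 2"
    and "distinct vs" and "set vs = verts G"
    and "A = adjacency_matrix G vs"
    and "k \<ge> 1" and "degree p \<le> k"
    and "poly p (nth_eigenvalue A 1) > min_poly_eigenvalue A p"
  shows "real (k_independence_number G k)
    \<le> real n *
      ((max_diag_poly A p - min_poly_eigenvalue A p) / (poly p (nth_eigenvalue A 1) - min_poly_eigenvalue A p))"
proof -
  interpret graph G using assms(1) by (simp add: regular_graph_def)
  obtain d0 where d0: "\<And>v. v \<in> verts G \<Longrightarrow> out_degree G v = d0"
    using assms(1) by (auto simp: regular_graph_def)
  define d where "d = real d0"
  have len: "length vs = n" using assms(2,4,5) by (metis distinct_card)
  have vs: "vs ! i \<in> verts G" if "i < n" for i using that assms(5) len by (metis nth_mem)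
  have A: "A \<in> carrier_mat n n" using assms(6) len by auto
  have sym: "transpose_mat A = A" using transpose_adjacency_matrix assms(6) by simp
  have row_sum: "(\<Sum>j=0..<n. A $$ (i, j)) = d" if "i < n" for i
    using that sum_row_adjacency_matrix[OF assms(4,5), of i] vs[OF that] d0
    by (simp add: assms(6) len d_def)
  define e :: "real vec" where "e = vec n (\<lambda>_. 1)"
  have e: "e \<in> carrier_vec n" by (simp add: e_def)
  have "e $ 0 \<noteq> 0\<^sub>v n $ 0" using \<open>n \<ge> 2\<close> by (simp add: e_def)
  then have "e \<noteq> 0\<^sub>v n" by metis
  moreover have "A *\<^sub>v e = d \<cdot>\<^sub>v e"
    using A by (intro eq_vecI) (auto simp: e_def scalar_prod_def row_sum)
  ultimately have ev: "eigenvector A e d" using A e by (auto simp: eigenvector_def)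
  have "\<theta> \<le> d" if "eigenvalue A \<theta>" for \<theta>
    using A _ _ that
  proof (rule eigenvalue_le_row_sum)
    show "0 \<le> A $$ (i, j)" if "i < n" "j < n" for i j
      using that by (simp add: assms(6) len index_adjacency_matrix)
  qed (simp add: row_sum)
  \<comment> \<open>Nonnegative entries with constant row sum \<open>d\<close> keep all eigenvalues
    at most \<open>d\<close>, so the eigenvalue of \<open>e\<close> heads the list.\<close>
  then have top: "nth_eigenvalue A 1 = d"
    using nth_eigenvalue_1[OF A] ev by (auto simp: eigenvalue_def)
  define l where "l = min_poly_eigenvalue A p"
  \<comment> \<open>The shift by \<open>l\<close> makes all eigenvalues of
    \<open>mat_poly q A\<close> nonnegative: they are values of \<open>q\<close> at eigenvalues of
    \<open>A\<close>.\<close>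
  define q where "q = p - [:l:]"
  define M where "M = mat_poly q A"
  have M: "M \<in> carrier_mat n n" using A by (simp add: M_def)
  have symM: "transpose_mat M = M" unfolding M_def by (rule transpose_mat_poly_symmetric[OF A sym])
  have "0 \<le> \<mu>" if "eigenvalue M \<mu>" for \<mu>
  proof -
    obtain \<theta> where \<theta>: "eigenvalue A \<theta>" "poly q \<theta> = \<mu>"
      using eigenvalue_mat_poly_symmetric[OF A sym] \<open>eigenvalue M \<mu>\<close> unfolding M_def by blast
    then show ?thesis
      using min_poly_eigenvalue_le[OF A _ \<theta>(1), of p] assms(9) by (simp add: q_def l_def)
  qed
  then have psd: "0 \<le> x \<bullet> (M *\<^sub>v x)" if "x \<in> carrier_vec n" for x
    using symmetric_psd_if_eigenvalues_nonneg[OF M symM] that by blast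
  have "M *\<^sub>v e = poly q d \<cdot>\<^sub>v e" unfolding M_def by (rule mat_poly_eigenvector[OF A ev])
  then have evM: "eigenvector M e (poly q d)"
    using ev A M by (auto simp: eigenvector_def)
  have "verts G \<noteq> {}" using assms(2,3) by auto
  then obtain S where S: "k_independent G k S" "card S = k_independence_number G k" "0 < card S"
    using k_independence_number_attained[OF finite_verts] by blast
  have SG: "S \<subseteq> verts G" using S(1) by (simp add: k_independent_def)
  \<comment> \<open>Matrices are indexed by positions in \<open>vs\<close>, so \<open>S\<close> is
    carried over to a set of positions of the same size.\<close>
  define U where "U = {i \<in> {0..<n}. vs ! i \<in> S}"
  have "card U = card (nth vs ` U)"
    using assms(4) len by (intro card_image[symmetric]) (auto simp: U_def inj_on_def nth_eq_iff_index_eq)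
  also have "nth vs ` U = S"
  proof
    show "S \<subseteq> nth vs ` U"
    proof
      fix v assume "v \<in> S"
      moreover from this obtain i where "i < n" "vs ! i = v"
        using SG assms(5) len by (metis in_set_conv_nth subset_iff)
      ultimately show "v \<in> nth vs ` U" by (auto simp: U_def)
    qed
  qed (auto simp: U_def)
  finally have cardU: "card U = card S" .
  define x :: "real vec" where "x = vec n (\<lambda>i. if i \<in> U then 1 else 0)"
  have x: "x \<in> carrier_vec n" by (simp add: x_def)
  have sumU: "(\<Sum>i=0..<n. (if i \<in> U then f i else 0)) = (\<Sum>i\<in>U. f i)" for f :: "nat \<Rightarrow> real"
  proof -
    have "{0..<n} \<inter> U = U" by (auto simp: U_def)
    then show ?thesis using sum.inter_restrict[of "{0..<n}" f U] by simp
  qed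
  have ee: "e \<bullet> e = real n" by (simp add: e_def scalar_prod_def)
  have xe: "x \<bullet> e = real (card S)"
    using sumU[of "\<lambda>_. 1"] by (simp add: e_def x_def scalar_prod_def cardU)
  have off_diag: "M $$ (i, j) = 0" if "i \<in> U" "j \<in> U" "i \<noteq> j" for i j
  proof -
    have ij: "i < n" "j < n" using that by (auto simp: U_def)
    have "vs ! i \<noteq> vs ! j" using that ij assms(4) len by (simp add: nth_eq_iff_index_eq)
    then have dist: "graph_dist G (vs ! i) (vs ! j) > ereal (real k)"
      using that S(1) by (auto simp: U_def k_independent_def)
    \<comment> \<open>Subtracting the constant \<open>l\<close> keeps the degree at most
      \<open>k\<close>. Only powers up to \<open>k\<close> enter, and the distance exceeds each of
      these exponents.\<close>
    have "degree q \<le> k" using degree_diff_le[of p k "[:l:]"] assms(8) by (simp add: q_def)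
    then have "M $$ (i, j) = (\<Sum>m\<le>k. coeff q m * (A ^\<^sub>m m) $$ (i, j))"
      unfolding M_def by (rule index_mat_poly[OF A _ ij])
    also have "\<dots> = 0"
    proof (intro sum.neutral ballI)
      fix m assume "m \<in> {..k}"
      then have "ereal (real m) < graph_dist G (vs ! i) (vs ! j)"
        using dist by (intro le_less_trans[OF _ dist]) simp
      then show "coeff q m * (A ^\<^sub>m m) $$ (i, j) = 0"
        using adjacency_matrix_pow_eq_0[OF assms(5)] ij len assms(6) by simp
    qed
    finally show ?thesis .
  qed
  have diag: "M $$ (i, i) \<le> max_diag_poly A p - l" if "i \<in> U" for i
  proof -
    have i: "i < n" using that by (simp add: U_def)
    have "M $$ (i, i) = mat_poly p A $$ (i, i) - l"
      using i A by (simp add: M_def q_def mat_poly_diff[OF A] mat_poly_const[OF A])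
    moreover have "mat_poly p A $$ (i, i) \<le> max_diag_poly A p"
      unfolding max_diag_poly_def poly_mat_eq_mat_poly using i A by (intro Max_ge) auto
    ultimately show ?thesis by simp
  qed
  have "x \<bullet> (M *\<^sub>v x) = (\<Sum>i=0..<n. x $ i * (\<Sum>j=0..<n. M $$ (i, j) * x $ j))"
    using M x by (simp add: scalar_prod_def)
  also have "\<dots> = (\<Sum>i\<in>U. \<Sum>j\<in>U. M $$ (i, j))"
  proof -
    have "(\<Sum>j=0..<n. M $$ (i, j) * x $ j) = (\<Sum>j\<in>U. M $$ (i, j))" for i
      unfolding sumU[symmetric] by (intro sum.cong) (auto simp: x_def)
    then show ?thesis
      unfolding sumU[symmetric] by (intro sum.cong) (auto simp: x_def)
  qed
  also have "\<dots> = (\<Sum>i\<in>U. M $$ (i, i))"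
  proof (intro sum.cong refl)
    fix i assume i: "i \<in> U"
    have "(\<Sum>j\<in>U. M $$ (i, j)) = (\<Sum>j\<in>U. if j = i then M $$ (i, i) else 0)"
      using off_diag i by (intro sum.cong) auto
    then show "(\<Sum>j\<in>U. M $$ (i, j)) = M $$ (i, i)" using i by (simp add: U_def)
  qed
  also have "\<dots> \<le> real (card S) * (max_diag_poly A p - l)"
    using sum_bounded_above[of U "\<lambda>i. M $$ (i, i)"] diag cardU by simp
  finally have form_le: "x \<bullet> (M *\<^sub>v x) \<le> real (card S) * (max_diag_poly A p - l)" .
  \<comment> \<open>The spectral lower bound, with \<open>poly q d\<close> the eigenvalue of
    \<open>M\<close> at \<open>e\<close>, \<open>n\<close> for \<open>e \<bullet> e\<close> and
    \<open>card S\<close> for \<open>x \<bullet> e\<close>, meets the upper bound from the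
    diagonal.\<close>
  have "poly q d * (real (card S))\<^sup>2 \<le> real n * (x \<bullet> (M *\<^sub>v x))"
    using psd_form_ge_eigenvector_part[OF M symM psd evM x] by (simp add: ee xe)
  also have "\<dots> \<le> real n * (real (card S) * (max_diag_poly A p - l))"
    using form_le by (intro mult_left_mono) auto
  finally have "real (card S) * (poly q d * real (card S))
      \<le> real (card S) * (real n * (max_diag_poly A p - l))"
    by (simp add: power2_eq_square mult_ac)
  then have "poly q d * real (card S) \<le> real n * (max_diag_poly A p - l)"
    using S(3) by simp
  moreover have "poly q d = poly p d - l" by (simp add: q_def)
  moreover have "0 < poly p d - l" using assms(9) unfolding top l_def by simp
  ultimately show ?thesis
    unfolding top l_def[symmetric] S(2)[symmetric] by (simp add: field_simps)
qed

end
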